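(* Let $i<j<k$ be indices in $\{1,\dots,n\}$ and consider the following inequalities in $(x,Y)$: (T25) $- u_iY_{jk}+ u_i\ell_kx_j + u_i\ell_jx_k - u_i\ell_j\ell_k \leq 0$; (T26) $- \ell_jY_{ik} + (u_k - \ell_k)Y_{ij} + (\ell_k - u_k)u_ix_j + \ell_j\ell_kx_i + u_i\ell_jx_k - u_i\ell_j\ell_k \leq 0$; (T27) $(u_j - \ell_j)Y_{ik} - \ell_kY_{ij} + u_i\ell_kx_j + \ell_j\ell_kx_i + u_i(\ell_j - u_j)x_k - u_i\ell_j\ell_k \leq 0$; (T28) $(\ell_i - u_i)Y_{jk} - \ell_jY_{ik} + (u_i - \ell_i)\ell_kx_j + \ell_j\ell_kx_i + u_i\ell_jx_k - u_i\ell_j\ell_k \leq 0$; (T29) $(\ell_i - u_i)Y_{jk} - \ell_kY_{ij} + u_i\ell_kx_j + \ell_j\ell_kx_i +(u_i -\ell_i)\ell_jx_k - u_i\ell_j\ell_k \leq 0$; (T30) $- u_i Y_{jk} + (u_j - \ell_j)Y_{ik} + (u_k - \ell_k) Y_{ij} + u_i\ell_kx_j + (\ell_j\ell_k -u_j u_k)x_i + u_i\ell_jx_k - u_i\ell_j\ell_k \leq 0$. Then (T30) cuts feasible solutions of $(P_{S_0,\ldots,S_m})$ (that is, it is violated by some feasible solution of $(P_{S_0,\ldots,S_m})$), while (T25), (T26), (T27), (T28) and (T29) are redundant for $(P_{S_0,\ldots,S_m})$ (that is, they are satisfied by every feasible solution of it).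
   Context: Problem $(P)$ is: minimize $\langle Q_0,xx^T\rangle+c_0^Tx$ over $x\in\mathbb{R}^n$ subject to $\langle Q_r,xx^T\rangle+c_r^Tx\le b_r$ for $r=1,\dots,m$ and $\ell_p\le x_p\le u_p$ for $p=1,\dots,n$. Here $Q_0,\dots,Q_m$ are symmetric $n\times n$ real matrices, $c_0,\dots,c_m\in\mathbb{R}^n$, $b\in\mathbb{R}^m$, $u\in\mathbb{R}^n$, $\ell\in\mathbb{R}_+^n$, the feasible domain of $(P)$ is assumed non-empty, and $\langle A,B\rangle=\sum_{p,q}a_{pq}b_{pq}$. Let $S_0,\dots,S_m$ be any symmetric positive semidefinite $n\times n$ matrices. The convex relaxation $(P_{S_0,\ldots,S_m})$ of $(P)$ is the problem of minimizing $\langle S_0,xx^T\rangle+c_0^Tx+\langle Q_0-S_0,Y\rangle$ over $(x,Y)\in\mathbb{R}^n\times\mathbb{R}^{n\times n}$ subject to: - $\ell_p\le x_p\le u_p$ for all $p$; - $\langle S_r,xx^T\rangle+c_r^Tx+\langle Q_r-S_r,Y\rangle\le b_r$ for $r=1,\dots,m$; - $Y_{qp}=Y_{pq}$ for all $p<q$; - the McCormick inequalities, for all $1\le p\le q\le n$: $Y_{pq}-u_qx_p-\ell_px_q+u_q\ell_p\le 0$, $Y_{pq}-u_px_q-\ell_qx_p+u_p\ell_q\le 0$, $-Y_{pq}+u_qx_p+u_px_q-u_pu_q\le 0$, $-Y_{pq}+\ell_qx_p+\ell_px_q-\ell_p\ell_q\le 0$.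
   Formalization: That (T30) cuts fails for some instances (e.g. ℓ=u, or ℓ_i=0 with a constraint x_i≤0); it is proved when ℓ_p<u_p for p=i,j,k and for all right-hand sides b_1,…,b_m above some threshold; redundancy of (T25)–(T29) is proved for the given b. *)

theory Defs
  imports "HOL-Analysis.Analysis"
begin

(* The index set {1..n} is a finite linearly ordered type 'n.  Index 0 of Q, c and S belongs to
   the objective and indices 1..m to the constraints.  The inner product of the library on
   real^'n^'n is the sum of a$p$q * b$p$q over all p and q. *)

(* real^'n would fix the sort of 'n to finite and so clash with the linear order. *)
type_synonym 'n rvec = "(real, 'n) vec"
type_synonym 'n rmat = "((real, 'n) vec, 'n) vec"

definition outer :: "'n::finite rvec \<Rightarrow> 'n rmat" where
  "outer x = (\<chi> p q. x $ p * x $ q)"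

definition sym_mat :: "'n::finite rmat \<Rightarrow> bool" where
  "sym_mat A \<longleftrightarrow> transpose A = A"

definition psd_mat :: "'n::finite rmat \<Rightarrow> bool" where
  "psd_mat A \<longleftrightarrow> sym_mat A \<and> (\<forall>x. 0 \<le> x \<bullet> (A *v x))"

definition feasible_P ::
  "nat \<Rightarrow> (nat \<Rightarrow> 'n::finite rmat) \<Rightarrow> (nat \<Rightarrow> 'n rvec) \<Rightarrow> (nat \<Rightarrow> real) \<Rightarrow> 'n rvec \<Rightarrow> 'n rvec
    \<Rightarrow> ('n rvec) set" where
  "feasible_P m Q c b l u =
     {x. (\<forall>r\<in>{1..m}. Q r \<bullet> outer x + c r \<bullet> x \<le> b r) \<and>
         (\<forall>p. l $ p \<le> x $ p \<and> x $ p \<le> u $ p)}"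

definition mccormick ::
  "'n::finite rvec \<Rightarrow> 'n rvec \<Rightarrow> 'n \<Rightarrow> 'n \<Rightarrow> 'n rvec \<Rightarrow> 'n rmat \<Rightarrow> bool" where
  "mccormick l u p q x Y \<longleftrightarrow>
     Y$p$q - u$q * x$p - l$p * x$q + u$q * l$p \<le> 0 \<and>
     Y$p$q - u$p * x$q - l$q * x$p + u$p * l$q \<le> 0 \<and>
     - Y$p$q + u$q * x$p + u$p * x$q - u$p * u$q \<le> 0 \<and>
     - Y$p$q + l$q * x$p + l$p * x$q - l$p * l$q \<le> 0"

definition feasible_relax ::
  "nat \<Rightarrow> (nat \<Rightarrow> 'n::{finite,linorder} rmat) \<Rightarrow> (nat \<Rightarrow> 'n rvec) \<Rightarrow> (nat \<Rightarrow> real)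
    \<Rightarrow> 'n rvec \<Rightarrow> 'n rvec \<Rightarrow> (nat \<Rightarrow> 'n rmat)
    \<Rightarrow> ('n rvec \<times> 'n rmat) set" where
  "feasible_relax m Q c b l u S =
     {(x, Y). (\<forall>p. l $ p \<le> x $ p \<and> x $ p \<le> u $ p) \<and>
        (\<forall>r\<in>{1..m}. S r \<bullet> outer x + c r \<bullet> x + (Q r - S r) \<bullet> Y \<le> b r) \<and>
        (\<forall>p q. p < q \<longrightarrow> Y$q$p = Y$p$q) \<and>
        (\<forall>p q. p \<le> q \<longrightarrow> mccormick l u p q x Y)}"

definition T25 ::
  "'n::finite rvec \<Rightarrow> 'n rvec \<Rightarrow> 'n \<Rightarrow> 'n \<Rightarrow> 'n \<Rightarrow> 'n rvec \<Rightarrow> 'n rmat \<Rightarrow> bool" where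
  "T25 l u i j k x Y \<longleftrightarrow>
     - u$i * Y$j$k + u$i * l$k * x$j + u$i * l$j * x$k - u$i * l$j * l$k \<le> 0"

definition T26 ::
  "'n::finite rvec \<Rightarrow> 'n rvec \<Rightarrow> 'n \<Rightarrow> 'n \<Rightarrow> 'n \<Rightarrow> 'n rvec \<Rightarrow> 'n rmat \<Rightarrow> bool" where
  "T26 l u i j k x Y \<longleftrightarrow>
     - l$j * Y$i$k + (u$k - l$k) * Y$i$j + (l$k - u$k) * u$i * x$j + l$j * l$k * x$i
       + u$i * l$j * x$k - u$i * l$j * l$k \<le> 0"

definition T27 ::
  "'n::finite rvec \<Rightarrow> 'n rvec \<Rightarrow> 'n \<Rightarrow> 'n \<Rightarrow> 'n \<Rightarrow> 'n rvec \<Rightarrow> 'n rmat \<Rightarrow> bool" where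
  "T27 l u i j k x Y \<longleftrightarrow>
     (u$j - l$j) * Y$i$k - l$k * Y$i$j + u$i * l$k * x$j + l$j * l$k * x$i
       + u$i * (l$j - u$j) * x$k - u$i * l$j * l$k \<le> 0"

definition T28 ::
  "'n::finite rvec \<Rightarrow> 'n rvec \<Rightarrow> 'n \<Rightarrow> 'n \<Rightarrow> 'n \<Rightarrow> 'n rvec \<Rightarrow> 'n rmat \<Rightarrow> bool" where
  "T28 l u i j k x Y \<longleftrightarrow>
     (l$i - u$i) * Y$j$k - l$j * Y$i$k + (u$i - l$i) * l$k * x$j + l$j * l$k * x$i
       + u$i * l$j * x$k - u$i * l$j * l$k \<le> 0"

definition T29 ::
  "'n::finite rvec \<Rightarrow> 'n rvec \<Rightarrow> 'n \<Rightarrow> 'n \<Rightarrow> 'n \<Rightarrow> 'n rvec \<Rightarrow> 'n rmat \<Rightarrow> bool" where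
  "T29 l u i j k x Y \<longleftrightarrow>
     (l$i - u$i) * Y$j$k - l$k * Y$i$j + u$i * l$k * x$j + l$j * l$k * x$i
       + (u$i - l$i) * l$j * x$k - u$i * l$j * l$k \<le> 0"

definition T30 ::
  "'n::finite rvec \<Rightarrow> 'n rvec \<Rightarrow> 'n \<Rightarrow> 'n \<Rightarrow> 'n \<Rightarrow> 'n rvec \<Rightarrow> 'n rmat \<Rightarrow> bool" where
  "T30 l u i j k x Y \<longleftrightarrow>
     - u$i * Y$j$k + (u$j - l$j) * Y$i$k + (u$k - l$k) * Y$i$j + u$i * l$k * x$j
       + (l$j * l$k - u$j * u$k) * x$i + u$i * l$j * x$k - u$i * l$j * l$k \<le> 0"

end

theory Submission
  imports Defs
begin

text \<open>
  Write \<open>d p = u p - l p\<close> and let \<open>M1, \<dots>, M4\<close> be the left-hand sides of the four McCormick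
  inequalities. Over the box, each of \<open>T25\<close> to \<open>T29\<close> is a combination of McCormick inequalities
  with nonnegative multipliers, so it is redundant (\<open>mccormick_imp_T25_to_T29\<close>):

    \<open>T25 = u i * M4 j k\<close>,
    \<open>T26 = d k * M2 i j + l j * M3 i k\<close>,
    \<open>T27 = d j * M2 i k + l k * M3 i j\<close>,
    \<open>T28 = d i * M4 j k + l j * M4 i k\<close>,
    \<open>T29 = d i * M4 j k + l k * M4 i j\<close>.

  The inequality \<open>T30\<close> couples all three pairs. In the coordinates \<open>t p = (x p - l p) / d p\<close> and
  \<open>y p q\<close>, the value that stands for \<open>t p * t q\<close>, its left-hand side divided by \<open>d j * d k\<close> is

    \<open>d i * (y i j + y i k - t i - y j k) + l i * (t j + t k - 1 - y j k)\<close>.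

  The second bracket is a McCormick inequality, the first is a triangle inequality, which
  McCormick inequalities do not imply because each of them sees one pair of indices only. The
  triangle inequality fails at the centre of the box if \<open>Y\<close> pretends that \<open>t i = t j\<close> and
  \<open>t i = t k\<close> almost surely while \<open>t j = 1 - t k\<close>: each pair taken alone is an average of two
  vertices of its rectangle, but no distribution has all three pairs. There the left-hand side
  of \<open>T30\<close> equals \<open>d i * d j * d k / 2\<close> (\<open>mccormick_point_violating_T30\<close>).
  The point depends on the box only, so right-hand sides
  that are large enough make it satisfy the constraints indexed by \<open>r\<close> as well.
\<close>

text \<open>
  Each case substitutes the combination displayed above; \<open>0 \<le> l\<close> and \<open>l \<le> u\<close> make its multipliers
  nonnegative.
\<close>

lemma mccormick_imp_T25_to_T29:
  assumes lu: "\<And>p. 0 \<le> l $ p" "\<And>p. l $ p \<le> u $ p"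
    and ij: "mccormick l u i j x Y" and ik: "mccormick l u i k x Y" and jk: "mccormick l u j k x Y"
  shows "T25 l u i j k x Y" "T26 l u i j k x Y" "T27 l u i j k x Y"
    "T28 l u i j k x Y" "T29 l u i j k x Y"
proof -
  have u: "0 \<le> u $ i"
    using lu order_trans by blast
  have d: "0 \<le> u $ p - l $ p" for p
    using lu(2)[of p] by simp
  note M = ij[unfolded mccormick_def] ik[unfolded mccormick_def] jk[unfolded mccormick_def]
  note nonpos = mult_nonneg_nonpos
  have jk4: "- Y$j$k + l$k * x$j + l$j * x$k - l$j * l$k \<le> 0"
    and ik2: "Y$i$k - u$i * x$k - l$k * x$i + u$i * l$k \<le> 0"
    and ik3: "- Y$i$k + u$k * x$i + u$i * x$k - u$i * u$k \<le> 0"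
    and ik4: "- Y$i$k + l$k * x$i + l$i * x$k - l$i * l$k \<le> 0"
    and ij2: "Y$i$j - u$i * x$j - l$j * x$i + u$i * l$j \<le> 0"
    and ij3: "- Y$i$j + u$j * x$i + u$i * x$j - u$i * u$j \<le> 0"
    and ij4: "- Y$i$j + l$j * x$i + l$i * x$j - l$i * l$j \<le> 0"
    using M by blast+
  show "T25 l u i j k x Y"
    using nonpos[OF u jk4] by (simp add: T25_def algebra_simps)
  show "T26 l u i j k x Y"
    using nonpos[OF d[of k] ij2] nonpos[OF lu(1)[of j] ik3]
    by (simp add: T26_def algebra_simps)
  show "T27 l u i j k x Y"
    using nonpos[OF d[of j] ik2] nonpos[OF lu(1)[of k] ij3]
    by (simp add: T27_def algebra_simps)
  show "T28 l u i j k x Y"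
    using nonpos[OF d[of i] jk4] nonpos[OF lu(1)[of j] ik4]
    by (simp add: T28_def algebra_simps)
  show "T29 l u i j k x Y"
    using nonpos[OF d[of i] jk4] nonpos[OF lu(1)[of k] ij4]
    by (simp add: T29_def algebra_simps)
qed

text \<open>
  A McCormick inequality is affine in \<open>(x p, x q, Y p q)\<close> and holds with \<open>Y p q = x p * x q\<close> at
  every vertex of the rectangle of \<open>p\<close> and \<open>q\<close>. Hence it holds at the average of two opposite
  vertices; both diagonals have the centre of the rectangle as midpoint.
\<close>

lemma mccormick_centre:
  assumes lu: "\<And>p. l $ p \<le> u $ p"
    and x: "\<And>p. x $ p = (l $ p + u $ p) / 2"
    and Y: "Y $ p $ q = (l $ p * l $ q + u $ p * u $ q) / 2 \<or>
            Y $ p $ q = (l $ p * u $ q + u $ p * l $ q) / 2"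
  shows "mccormick l u p q x Y"
proof -
  have "0 \<le> (u $ p - l $ p) * (u $ q - l $ q)"
    using lu by simp
  with Y show ?thesis
    by (auto simp: mccormick_def x field_simps)
qed

text \<open>
  The matrix puts \<open>Y j k\<close> on the anti-diagonal and every other entry on the diagonal of its
  rectangle: \<open>j\<close> and \<open>k\<close> both follow \<open>i\<close> but oppose each other.
\<close>

lemma mccormick_point_violating_T30:
  fixes l u :: "'n::finite rvec" and i j k :: 'n
  assumes lu: "\<And>p. l $ p \<le> u $ p"
    and strict: "l $ i < u $ i" "l $ j < u $ j" "l $ k < u $ k"
    and distinct: "i \<noteq> j" "i \<noteq> k"
  obtains x :: "'n rvec" and Y :: "'n rmat"
  where "\<And>p. l $ p \<le> x $ p \<and> x $ p \<le> u $ p" "\<And>p q. Y $ q $ p = Y $ p $ q"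
    "\<And>p q. mccormick l u p q x Y" "\<not> T30 l u i j k x Y"
proof
  define x :: "'n rvec" where "x = (\<chi> p. (l $ p + u $ p) / 2)"
  define Y :: "'n rmat" where "Y = (\<chi> p q. if {p, q} = {j, k}
    then (l $ p * u $ q + u $ p * l $ q) / 2 else (l $ p * l $ q + u $ p * u $ q) / 2)"
  show "l $ p \<le> x $ p \<and> x $ p \<le> u $ p" for p
    using lu[of p] by (simp add: x_def)
  show "Y $ q $ p = Y $ p $ q" for p q
    by (simp add: Y_def insert_commute algebra_simps)
  show "mccormick l u p q x Y" for p q
    by (rule mccormick_centre) (auto simp: lu x_def Y_def)
  have entries: "Y $ j $ k = (l $ j * u $ k + u $ j * l $ k) / 2"
    "Y $ i $ j = (l $ i * l $ j + u $ i * u $ j) / 2"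
    "Y $ i $ k = (l $ i * l $ k + u $ i * u $ k) / 2"
    using distinct by (auto simp: Y_def doubleton_eq_iff)
  have "- u$i * Y$j$k + (u$j - l$j) * Y$i$k + (u$k - l$k) * Y$i$j + u$i * l$k * x$j
      + (l$j * l$k - u$j * u$k) * x$i + u$i * l$j * x$k - u$i * l$j * l$k
    = (u $ i - l $ i) * (u $ j - l $ j) * (u $ k - l $ k) / 2"
    unfolding entries by (simp add: x_def field_simps)
  also have "\<dots> > 0"
    using strict by simp
  finally show "\<not> T30 l u i j k x Y"
    by (simp add: T30_def)
qed

theorem proposition5:
  fixes m :: nat
    and Q S :: "nat \<Rightarrow> 'n::{finite,linorder} rmat"
    and c :: "nat \<Rightarrow> 'n rvec"
    and b :: "nat \<Rightarrow> real"
    and l u :: "'n rvec"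
    and i j k :: 'n
  assumes "\<And>r. r \<le> m \<Longrightarrow> sym_mat (Q r)"
    and "\<And>r. r \<le> m \<Longrightarrow> psd_mat (S r)"
    and "\<And>p. 0 \<le> l $ p"
    and "feasible_P m Q c b l u \<noteq> {}"
    and "i < j" and "j < k"
  shows "(l$i < u$i \<and> l$j < u$j \<and> l$k < u$k \<longrightarrow>
            (\<exists>b\<^sub>0. \<forall>b'. (\<forall>r\<in>{1..m}. b\<^sub>0 r \<le> b' r) \<longrightarrow>
               feasible_P m Q c b' l u \<noteq> {} \<and>
               (\<exists>(x, Y)\<in>feasible_relax m Q c b' l u S. \<not> T30 l u i j k x Y))) \<and>
         (\<forall>(x, Y)\<in>feasible_relax m Q c b l u S.
            T25 l u i j k x Y \<and> T26 l u i j k x Y \<and> T27 l u i j k x Y \<and>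
            T28 l u i j k x Y \<and> T29 l u i j k x Y)"
proof -
  from assms(4) obtain x0 where x0: "x0 \<in> feasible_P m Q c b l u"
    by blast
  have lu: "l $ p \<le> u $ p" for p
    using x0 by (auto simp: feasible_P_def intro: order_trans)
  show ?thesis
  proof (intro conjI impI)
    assume "l$i < u$i \<and> l$j < u$j \<and> l$k < u$k"
    then obtain x Y where box: "\<And>p. l $ p \<le> x $ p \<and> x $ p \<le> u $ p"
      and sym: "\<And>p q. Y $ q $ p = Y $ p $ q"
      and mc: "\<And>p q. mccormick l u p q x Y"
      and viol: "\<not> T30 l u i j k x Y"
      using mccormick_point_violating_T30[of l u i j k] lu assms(5,6)
      by (metis order.strict_trans less_irrefl)
    \<comment> \<open>The first argument of the maximum keeps the feasible point of the original problem, the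
        second admits the violating point.\<close>
    define b0 where
      "b0 r = max (b r) (S r \<bullet> outer x + c r \<bullet> x + (Q r - S r) \<bullet> Y)" for r
    have "feasible_P m Q c b' l u \<noteq> {} \<and>
        (\<exists>(x, Y)\<in>feasible_relax m Q c b' l u S. \<not> T30 l u i j k x Y)"
      if "\<forall>r\<in>{1..m}. b0 r \<le> b' r" for b'
    proof
      have b': "b r \<le> b' r" "S r \<bullet> outer x + c r \<bullet> x + (Q r - S r) \<bullet> Y \<le> b' r"
        if "r \<in> {1..m}" for r
        using \<open>\<forall>r\<in>{1..m}. b0 r \<le> b' r\<close> that by (auto simp: b0_def)
      have "x0 \<in> feasible_P m Q c b' l u"
        using x0 b'(1) unfolding feasible_P_def by (fastforce intro: order_trans)
      then show "feasible_P m Q c b' l u \<noteq> {}"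
        by blast
      have "(x, Y) \<in> feasible_relax m Q c b' l u S"
        using box sym mc b'(2) by (simp add: feasible_relax_def)
      with viol show "\<exists>(x, Y)\<in>feasible_relax m Q c b' l u S. \<not> T30 l u i j k x Y"
        by blast
    qed
    then show "\<exists>b\<^sub>0. \<forall>b'. (\<forall>r\<in>{1..m}. b\<^sub>0 r \<le> b' r) \<longrightarrow>
        feasible_P m Q c b' l u \<noteq> {} \<and>
        (\<exists>(x, Y)\<in>feasible_relax m Q c b' l u S. \<not> T30 l u i j k x Y)"
      by blast
  next
    show "\<forall>(x, Y)\<in>feasible_relax m Q c b l u S.
      T25 l u i j k x Y \<and> T26 l u i j k x Y \<and> T27 l u i j k x Y \<and>
      T28 l u i j k x Y \<and> T29 l u i j k x Y"
    proof clarify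
      fix x Y assume "(x, Y) \<in> feasible_relax m Q c b l u S"
      then have mc: "mccormick l u p q x Y" if "p \<le> q" for p q
        using that by (simp add: feasible_relax_def)
      have "mccormick l u i j x Y" "mccormick l u i k x Y" "mccormick l u j k x Y"
        using assms(5,6) by (auto intro!: mc)
      from mccormick_imp_T25_to_T29[OF assms(3) lu this]
      show "T25 l u i j k x Y \<and> T26 l u i j k x Y \<and> T27 l u i j k x Y \<and>
        T28 l u i j k x Y \<and> T29 l u i j k x Y"
        by blast
    qed
  qed
qed

end
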